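(* Let $\mathcal{I}\subseteq\mathcal{P}(\omega)$ be an ideal containing all finite subsets of $\omega$. Then $(\mathcal{I},\subseteq)$ is basic (with respect to the topology inherited from the Cantor space $\mathcal{P}(\omega)\cong 2^\omega$) if and only if $\mathcal{I}$ is a non-meager p-ideal. Consequently, a nonprincipal ultrafilter $\mathcal{U}$ on $\omega$, ordered by $\supseteq$, is basic if and only if $\mathcal{U}$ is a p-point.
   Context: A separable metric space $D$ with a partial order $\le$ is called basic if (1) every pair of elements of $D$ has a least upper bound and the binary least-upper-bound operation $D\times D\to D$ is continuous; (2) every bounded sequence has a convergent subsequence (converging to an element of $D$); (3) every sequence converging to an element of $D$ has a bounded subsequence. Subsets of $\mathcal{P}(\omega)$ carry the topology of the Cantor space, so $W_n\to W$ iff for each $m$ there is $k$ with $W_n\cap m=W\cap m$ for all $n\ge k$. An ideal is ordered by $\subseteq$ (upper bounds are supersets), an ultrafilter by $\supseteq$ (upper bounds are subsets). An ideal $\mathcal{I}$ is a p-ideal if for every countable $\{A_n:n<\omega\}\subseteq\mathcal{I}$ there is $A\in\mathcal{I}$ with $A_n\subseteq^* A$ (i.e. $A_n\setminus A$ finite) for all $n$. An ultrafilter $\mathcal{U}$ is a p-point if for every $\{X_n:n<\omega\}\subseteq\mathcal{U}$ there is $X\in\mathcal{U}$ with $X\subseteq^* X_n$ for all $n$. *)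

theory Defs
  imports "HOL-Analysis.Analysis"
begin

section \<open>Basic orders\<close>

definition is_lub :: "'a set \<Rightarrow> ('a \<Rightarrow> 'a \<Rightarrow> bool) \<Rightarrow> 'a \<Rightarrow> 'a \<Rightarrow> 'a \<Rightarrow> bool" where
  "is_lub D le x y z \<longleftrightarrow>
     z \<in> D \<and> le x z \<and> le y z \<and> (\<forall>w\<in>D. le x w \<and> le y w \<longrightarrow> le z w)"

definition bounded_seq :: "'a set \<Rightarrow> ('a \<Rightarrow> 'a \<Rightarrow> bool) \<Rightarrow> (nat \<Rightarrow> 'a) \<Rightarrow> bool" where
  "bounded_seq D le s \<longleftrightarrow> (\<exists>b\<in>D. \<forall>n. le (s n) b)"

text \<open>
  The space is given by its topology, with underlying set \<open>topspace X\<close>; the metric enters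
  the notion only through metrizability. Boundedness always refers to the order, with the
  bound taken in \<open>topspace X\<close>. By antisymmetry the operation \<open>lub\<close> below is uniquely
  determined on \<open>topspace X\<close>.
\<close>

definition basic :: "'a topology \<Rightarrow> ('a \<Rightarrow> 'a \<Rightarrow> bool) \<Rightarrow> bool" where
  "basic X le \<longleftrightarrow>
     metrizable_space X \<and> separable_space X \<and>
     reflp_on (topspace X) le \<and> antisymp_on (topspace X) le \<and> transp_on (topspace X) le \<and>
     (\<exists>lub. (\<forall>x\<in>topspace X. \<forall>y\<in>topspace X. is_lub (topspace X) le x y (lub x y)) \<and>
            continuous_map (prod_topology X X) X (\<lambda>(x, y). lub x y)) \<and>
     (\<forall>s. range s \<subseteq> topspace X \<and> bounded_seq (topspace X) le s \<longrightarrow>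
        (\<exists>r l. strict_mono r \<and> limitin X (s \<circ> r) l sequentially)) \<and>
     (\<forall>s l. range s \<subseteq> topspace X \<and> limitin X s l sequentially \<longrightarrow>
        (\<exists>r. strict_mono r \<and> bounded_seq (topspace X) le (s \<circ> r)))"


section \<open>The Cantor space topology on sets of natural numbers\<close>

definition cantor_topology :: "nat set topology" where
  "cantor_topology =
     pullback_topology UNIV (\<lambda>A n. n \<in> A)
       (product_topology (\<lambda>_. discrete_topology (UNIV :: bool set)) UNIV)"

lemma topspace_cantor_topology [simp]: "topspace cantor_topology = UNIV"
  by (simp add: cantor_topology_def topspace_pullback_topology)

lemma limitin_cantor_topology:
  "limitin cantor_topology W A sequentially \<longleftrightarrow>
     (\<forall>m. \<exists>k. \<forall>n\<ge>k. W n \<inter> {..<m} = A \<inter> {..<m})"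
proof -
  let ?P = "product_topology (\<lambda>_. discrete_topology (UNIV :: bool set)) (UNIV :: nat set)"
  let ?c = "\<lambda>A n::nat. n \<in> A"
  have disc: "limitin (discrete_topology (UNIV :: bool set)) f b F \<longleftrightarrow>
                eventually (\<lambda>n. f n \<longleftrightarrow> b) F" for f b and F :: "nat filter"
  proof
    assume "limitin (discrete_topology UNIV) f b F"
    then have "eventually (\<lambda>n. f n \<in> {b}) F"
      unfolding limitin_def by (metis insertI1 openin_discrete_topology subset_UNIV)
    then show "eventually (\<lambda>n. f n \<longleftrightarrow> b) F" by simp
  next
    assume "eventually (\<lambda>n. f n \<longleftrightarrow> b) F"
    then show "limitin (discrete_topology UNIV) f b F"
      unfolding limitin_def by (auto elim: eventually_mono)
  qed
  have ex: "openin cantor_topology S \<longleftrightarrow> (\<exists>V. openin ?P V \<and> S = ?c -` V)" for S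
    by (simp add: cantor_topology_def openin_pullback_topology)
  have "limitin cantor_topology W A sequentially \<longleftrightarrow>
          limitin ?P (\<lambda>n. ?c (W n)) (?c A) sequentially" (is "?L \<longleftrightarrow> ?R")
  proof
    assume L: ?L
    have "eventually (\<lambda>n. ?c (W n) \<in> V) sequentially" if "openin ?P V" "?c A \<in> V" for V
    proof -
      have "openin cantor_topology (?c -` V)" "A \<in> ?c -` V"
        using that ex by auto
      then have "eventually (\<lambda>n. W n \<in> ?c -` V) sequentially"
        using L unfolding limitin_def by blast
      then show ?thesis by simp
    qed
    then show ?R by (simp add: limitin_def)
  next
    assume R: ?R
    have "eventually (\<lambda>n. W n \<in> S) sequentially" if S: "openin cantor_topology S" "A \<in> S" for S
    proof -
      obtain V where V: "openin ?P V" "S = ?c -` V"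
        using S ex by auto
      then have "eventually (\<lambda>n. ?c (W n) \<in> V) sequentially"
        using R S unfolding limitin_def by auto
      then show ?thesis using V by simp
    qed
    then show ?L by (simp add: limitin_def)
  qed
  also have "\<dots> \<longleftrightarrow> (\<forall>i. eventually (\<lambda>n. i \<in> W n \<longleftrightarrow> i \<in> A) sequentially)"
    by (simp add: limitin_componentwise disc)
  also have "\<dots> \<longleftrightarrow> (\<forall>m. eventually (\<lambda>n. \<forall>i\<in>{..<m}. i \<in> W n \<longleftrightarrow> i \<in> A) sequentially)"
    by (subst eventually_ball_finite_distrib) auto
  also have "\<dots> \<longleftrightarrow> (\<forall>m. eventually (\<lambda>n. W n \<inter> {..<m} = A \<inter> {..<m}) sequentially)"
    by (intro iff_allI arg_cong2[where f = eventually] ext) (auto simp: set_eq_iff)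
  also have "\<dots> \<longleftrightarrow> (\<forall>m. \<exists>k. \<forall>n\<ge>k. W n \<inter> {..<m} = A \<inter> {..<m})"
    by (simp only: eventually_sequentially)
  finally show ?thesis .
qed


section \<open>Meager sets\<close>

definition nowhere_dense_in :: "'a topology \<Rightarrow> 'a set \<Rightarrow> bool" where
  "nowhere_dense_in X S \<longleftrightarrow> S \<subseteq> topspace X \<and> X interior_of (X closure_of S) = {}"

definition meager_in :: "'a topology \<Rightarrow> 'a set \<Rightarrow> bool" where
  "meager_in X S \<longleftrightarrow>
     (\<exists>\<N>. countable \<N> \<and> (\<forall>N\<in>\<N>. nowhere_dense_in X N) \<and> S = \<Union>\<N>)"


section \<open>Ideals and ultrafilters on the natural numbers\<close>

definition almost_subset :: "nat set \<Rightarrow> nat set \<Rightarrow> bool"  (infix "\<subseteq>\<^sup>*" 50) where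
  "A \<subseteq>\<^sup>* B \<longleftrightarrow> finite (A - B)"

text \<open>Ideals are not required to be proper.\<close>

definition set_ideal :: "nat set set \<Rightarrow> bool" where
  "set_ideal \<I> \<longleftrightarrow>
     {} \<in> \<I> \<and>
     (\<forall>A B. A \<in> \<I> \<and> B \<subseteq> A \<longrightarrow> B \<in> \<I>) \<and>
     (\<forall>A B. A \<in> \<I> \<and> B \<in> \<I> \<longrightarrow> A \<union> B \<in> \<I>)"

definition p_ideal :: "nat set set \<Rightarrow> bool" where
  "p_ideal \<I> \<longleftrightarrow>
     set_ideal \<I> \<and>
     (\<forall>A :: nat \<Rightarrow> nat set. range A \<subseteq> \<I> \<longrightarrow> (\<exists>B\<in>\<I>. \<forall>n. A n \<subseteq>\<^sup>* B))"

definition ultrafilter :: "nat set set \<Rightarrow> bool" where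
  "ultrafilter \<U> \<longleftrightarrow>
     UNIV \<in> \<U> \<and> {} \<notin> \<U> \<and>
     (\<forall>A B. A \<in> \<U> \<and> A \<subseteq> B \<longrightarrow> B \<in> \<U>) \<and>
     (\<forall>A B. A \<in> \<U> \<and> B \<in> \<U> \<longrightarrow> A \<inter> B \<in> \<U>) \<and>
     (\<forall>A. A \<in> \<U> \<or> - A \<in> \<U>)"

definition nonprincipal :: "nat set set \<Rightarrow> bool" where
  "nonprincipal \<U> \<longleftrightarrow> \<not> (\<exists>S. \<U> = {A. S \<subseteq> A})"

definition p_point :: "nat set set \<Rightarrow> bool" where
  "p_point \<U> \<longleftrightarrow>
     ultrafilter \<U> \<and>
     (\<forall>X :: nat \<Rightarrow> nat set. range X \<subseteq> \<U> \<longrightarrow> (\<exists>Y\<in>\<U>. \<forall>n. Y \<subseteq>\<^sup>* X n))"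

end

theory Submission
  imports Defs
begin

text \<open>
  By compactness of the Cantor space, only the existence of bounded subsequences of convergent
  sequences is at stake. A sequence converging in a
  p-ideal is, modulo a single member of the ideal, a sequence of finite sets \<open>C n\<close> tending to the
  empty set, and the sets \<open>X\<close> that include infinitely many \<open>C n\<close> are comeager; so a non-meager
  ideal contains one. Conversely, in a meager ideal (Talagrand, Jalali-Naini) there are
  finite sets tending to the empty set, no infinitely many of which have their union in the ideal.
  For ultrafilters one passes to the dual ideal, which is never meager: splitting the finite
  sets into two infinite families would give two disjoint members of the ultrafilter.
\<close>

subsection \<open>Cylinders in the Cantor space\<close>

lemma cylinder_mono:
  fixes X Y :: "nat set"
  assumes "X \<inter> {..<j} = Y \<inter> {..<j}" "i \<le> j"
  shows "X \<inter> {..<i} = Y \<inter> {..<i}"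
proof -
  have "{..<i} = {..<j} \<inter> {..<i}" using assms(2) by auto
  then show ?thesis using assms(1) by (metis inf_assoc)
qed

text \<open>A basic open set of the product restricts only finitely many coordinates, so any
  \<open>m\<close> above them gives a cylinder inside it; conversely, a cylinder is a box with
  singleton factors below \<open>m\<close>.\<close>

lemma openin_cantor_topology:
  "openin cantor_topology S \<longleftrightarrow>
     (\<forall>A\<in>S. \<exists>m. \<forall>B. B \<inter> {..<m} = A \<inter> {..<m} \<longrightarrow> B \<in> S)"
proof -
  let ?P = "product_topology (\<lambda>_. discrete_topology (UNIV :: bool set)) (UNIV :: nat set)"
  let ?c = "\<lambda>A n::nat. n \<in> A"
  have ex: "openin cantor_topology S \<longleftrightarrow> (\<exists>V. openin ?P V \<and> S = ?c -` V)" for S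
    by (simp add: cantor_topology_def openin_pullback_topology)
  show ?thesis
  proof
    assume "openin cantor_topology S"
    then obtain V where V: "openin ?P V" "S = ?c -` V"
      using ex by auto
    show "\<forall>A\<in>S. \<exists>m. \<forall>B. B \<inter> {..<m} = A \<inter> {..<m} \<longrightarrow> B \<in> S"
    proof
      fix A assume "A \<in> S"
      then have "?c A \<in> V" using V by auto
      then obtain U where U: "finite {i. U i \<noteq> (UNIV :: bool set)}"
        "?c A \<in> Pi\<^sub>E UNIV U" "Pi\<^sub>E UNIV U \<subseteq> V"
        using V(1) unfolding openin_product_topology_alt by fastforce
      obtain m where m: "\<forall>i\<in>{i. U i \<noteq> UNIV}. i < m"
        using U(1) finite_nat_set_iff_bounded by blast
      have "B \<in> S" if "B \<inter> {..<m} = A \<inter> {..<m}" for B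
      proof -
        have "(i \<in> B) \<in> U i" for i
        proof (cases "U i = UNIV")
          case False
          then have "i \<in> B \<longleftrightarrow> i \<in> A" using m that by blast
          then show ?thesis using U(2) by (auto simp: PiE_UNIV_domain)
        qed simp
        then have "?c B \<in> V" using U(3) by (auto simp: PiE_UNIV_domain)
        then show ?thesis using V by simp
      qed
      then show "\<exists>m. \<forall>B. B \<inter> {..<m} = A \<inter> {..<m} \<longrightarrow> B \<in> S" by blast
    qed
  next
    assume R: "\<forall>A\<in>S. \<exists>m. \<forall>B. B \<inter> {..<m} = A \<inter> {..<m} \<longrightarrow> B \<in> S"
    have "\<exists>U. openin cantor_topology U \<and> A \<in> U \<and> U \<subseteq> S" if "A \<in> S" for A
    proof -
      obtain m where m: "\<forall>B. B \<inter> {..<m} = A \<inter> {..<m} \<longrightarrow> B \<in> S"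
        using bspec[OF R \<open>A \<in> S\<close>] ..
      let ?U = "\<lambda>i. if i < m then {i \<in> A} else UNIV"
      have "{i. i < m \<and> {i \<in> A} \<noteq> UNIV} \<subseteq> {..<m}" by auto
      then have "finite {i. i < m \<and> {i \<in> A} \<noteq> UNIV}"
        using finite_subset by blast
      then have "openin ?P (Pi\<^sub>E UNIV ?U)"
        by (simp add: openin_PiE_gen)
      then have "openin cantor_topology (?c -` Pi\<^sub>E UNIV ?U)" using ex by blast
      moreover have "A \<in> ?c -` Pi\<^sub>E UNIV ?U" by auto
      moreover have "?c -` Pi\<^sub>E UNIV ?U \<subseteq> S"
      proof
        fix B assume "B \<in> ?c -` Pi\<^sub>E UNIV ?U"
        then have "(i \<in> B) \<in> ?U i" for i by (simp add: PiE_iff)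
        then have "(i \<in> B) \<in> {i \<in> A}" if "i < m" for i using that by metis
        then have "B \<inter> {..<m} = A \<inter> {..<m}" by blast
        then show "B \<in> S" using m by simp
      qed
      ultimately show ?thesis by blast
    qed
    then show "openin cantor_topology S" by (subst openin_subopen) blast
  qed
qed

lemma openin_cantor_topologyE:
  assumes "openin cantor_topology S" "A \<in> S"
  obtains m where "\<And>B. B \<inter> {..<m} = A \<inter> {..<m} \<Longrightarrow> B \<in> S"
proof -
  obtain m where "\<forall>B. B \<inter> {..<m} = A \<inter> {..<m} \<longrightarrow> B \<in> S"
    using bspec[OF iffD1[OF openin_cantor_topology assms(1)] assms(2)] ..
  then show thesis by (intro that[of m]) simp
qed

lemma openin_cantor_cylinder:
  "openin cantor_topology {B. B \<inter> {..<m} = A \<inter> {..<m}}"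
  by (auto simp: openin_cantor_topology)

section \<open>Topological properties of the Cantor space\<close>

text \<open>The topology is pulled back along a bijection, namely characteristic functions.
  Metrizability and compactness thus carry over from the countable product of two-point
  spaces.\<close>

lemma homeomorphic_cantor_topology:
  "cantor_topology homeomorphic_space
     product_topology (\<lambda>_. discrete_topology (UNIV :: bool set)) (UNIV :: nat set)"
proof -
  let ?P = "product_topology (\<lambda>_. discrete_topology (UNIV :: bool set)) (UNIV :: nat set)"
  let ?c = "\<lambda>A n::nat. n \<in> A"
  have surj: "surj ?c"
    by (rule surjI[where f = Collect]) auto
  have "openin cantor_topology (?c -` U) \<longleftrightarrow> openin ?P U" for U
    using surj by (auto simp: cantor_topology_def openin_pullback_topology) (metis surj_image_vimage_eq)
  moreover have "inj ?c" by (auto simp: inj_def fun_eq_iff)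
  ultimately have "homeomorphic_map cantor_topology ?P ?c"
    using surj by (simp add: homeomorphic_map_def quotient_map_def vimage_def)
  then show ?thesis
    using homeomorphic_map_imp_homeomorphic_space by blast
qed

lemma metrizable_cantor_topology: "metrizable_space cantor_topology"
  using homeomorphic_metrizable_space[OF homeomorphic_cantor_topology]
  by (simp add: metrizable_space_product_topology metrizable_space_discrete_topology)

lemma compact_cantor_topology: "compact_space cantor_topology"
  using homeomorphic_compact_space[OF homeomorphic_cantor_topology]
  by (simp add: compact_space_product_topology compact_space_discrete_topology)

text \<open>A cylinder depends only on \<open>m\<close> and on the finite trace of a set below
  \<open>m\<close>, so there are countably many.\<close>

lemma second_countable_cantor_topology: "second_countable cantor_topology"
  unfolding second_countable_def
proof (intro exI conjI ballI allI impI)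
  let ?B = "(\<lambda>(m, F). {B. B \<inter> {..<m} = F \<inter> {..<m}}) ` (UNIV \<times> {F :: nat set. finite F})"
  show "countable ?B"
    by (intro countable_image countable_SIGMA countable_Collect_finite) auto
  show "openin cantor_topology V" if "V \<in> ?B" for V
    using that openin_cantor_cylinder by auto
  show "\<exists>V\<in>?B. A \<in> V \<and> V \<subseteq> S" if "openin cantor_topology S \<and> A \<in> S" for S A
  proof -
    from that obtain m where m: "\<And>B. B \<inter> {..<m} = A \<inter> {..<m} \<Longrightarrow> B \<in> S"
      using openin_cantor_topologyE by metis
    have "{B. B \<inter> {..<m} = (A \<inter> {..<m}) \<inter> {..<m}} \<in> ?B"
      by (rule image_eqI[where x = "(m, A \<inter> {..<m})"]) auto
    moreover have "A \<in> {B. B \<inter> {..<m} = (A \<inter> {..<m}) \<inter> {..<m}}" by auto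
    moreover have "{B. B \<inter> {..<m} = (A \<inter> {..<m}) \<inter> {..<m}} \<subseteq> S" using m by auto
    ultimately show ?thesis by (intro bexI conjI)
  qed
qed

text \<open>Separability need not pass to subspaces, but second countability does, and it implies
  separability.\<close>

lemma separable_subtopology_cantor: "separable_space (subtopology cantor_topology D)"
  by (intro second_countable_imp_separable_space second_countable_subtopology
      second_countable_cantor_topology)

lemma cantor_convergent_subsequence:
  fixes W :: "nat \<Rightarrow> nat set"
  obtains r A where "strict_mono r" "limitin cantor_topology (W \<circ> r) A sequentially"
proof -
  obtain M d where M: "Metric_space M d" "cantor_topology = Metric_space.mtopology M d"
    using metrizable_cantor_topology unfolding metrizable_space_def by blast
  interpret Metric_space M d by (rule M(1))
  have "M = UNIV" using M(2) topspace_mtopology topspace_cantor_topology by metis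
  then show thesis
    using compact_cantor_topology that unfolding M(2) compact_space_sequentially by blast
qed

text \<open>By hypothesis the bits of the value below \<open>m\<close> depend only on the bits of
  the arguments below \<open>m\<close>, so a product of two cylinders of length \<open>m\<close> is
  mapped into one.\<close>

lemma continuous_map_cantor_binary:
  fixes f :: "nat set \<Rightarrow> nat set \<Rightarrow> nat set"
  assumes f: "\<And>m A B A' B'. A \<inter> {..<m} = A' \<inter> {..<m} \<Longrightarrow> B \<inter> {..<m} = B' \<inter> {..<m} \<Longrightarrow>
                f A B \<inter> {..<m} = f A' B' \<inter> {..<m}"
  shows "continuous_map (prod_topology cantor_topology cantor_topology) cantor_topology
           (\<lambda>(A, B). f A B)"
  unfolding continuous_map_def
proof (intro conjI allI impI)
  fix S assume S: "openin cantor_topology S"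
  show "openin (prod_topology cantor_topology cantor_topology)
          {x \<in> topspace (prod_topology cantor_topology cantor_topology). (case x of (A, B) \<Rightarrow> f A B) \<in> S}"
    unfolding openin_prod_topology_alt
  proof (intro allI impI)
    fix A B
    assume "(A, B) \<in> {x \<in> topspace (prod_topology cantor_topology cantor_topology).
                        (case x of (A, B) \<Rightarrow> f A B) \<in> S}"
    then have "f A B \<in> S" by simp
    then obtain m where m: "\<And>C. C \<inter> {..<m} = f A B \<inter> {..<m} \<Longrightarrow> C \<in> S"
      using S openin_cantor_topologyE by metis
    let ?U = "\<lambda>A :: nat set. {A'. A' \<inter> {..<m} = A \<inter> {..<m}}"
    have sub: "?U A \<times> ?U B \<subseteq> {x \<in> topspace (prod_topology cantor_topology cantor_topology).
                            (case x of (A, B) \<Rightarrow> f A B) \<in> S}"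
    proof clarify
      fix A' B' assume "A' \<inter> {..<m} = A \<inter> {..<m}" "B' \<inter> {..<m} = B \<inter> {..<m}"
      then have "f A' B' \<in> S" by (intro m f)
      then show "(A', B') \<in> topspace (prod_topology cantor_topology cantor_topology) \<and>
          f A' B' \<in> S" by simp
    qed
    show "\<exists>U V. openin cantor_topology U \<and> openin cantor_topology V \<and> A \<in> U \<and> B \<in> V \<and>
        U \<times> V \<subseteq> {x \<in> topspace (prod_topology cantor_topology cantor_topology).
                    (case x of (A, B) \<Rightarrow> f A B) \<in> S}"
      by (rule exI[of _ "?U A"], rule exI[of _ "?U B"])
        (intro conjI openin_cantor_cylinder sub CollectI refl)
  qed
qed auto

subsection \<open>Basic orders on subspaces of the Cantor space\<close>

text \<open>Isolates the clause of \<open>basic\<close> that is not automatic. Convergence is taken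
  in the whole Cantor space, which agrees with convergence in the subspace once the limit lies in
  \<open>D\<close>.\<close>

definition convergent_imp_bounded :: "nat set set \<Rightarrow> (nat set \<Rightarrow> nat set \<Rightarrow> bool) \<Rightarrow> bool" where
  "convergent_imp_bounded D le \<longleftrightarrow>
     (\<forall>s l. range s \<subseteq> D \<and> l \<in> D \<and> limitin cantor_topology s l sequentially \<longrightarrow>
        (\<exists>r. strict_mono r \<and> bounded_seq D le (s \<circ> r)))"

text \<open>\<open>lub\<close> and \<open>cont\<close> give the continuous least upper bound.
  Compactness gives a bounded sequence a convergent subsequence, and \<open>closed\<close> keeps its
  limit in \<open>D\<close>.\<close>

lemma basic_subtopology_cantor_iff:
  fixes lub :: "nat set \<Rightarrow> nat set \<Rightarrow> nat set"
  assumes ord: "reflp_on D le" "antisymp_on D le" "transp_on D le"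
    and lub: "\<And>A B. A \<in> D \<Longrightarrow> B \<in> D \<Longrightarrow> is_lub D le A B (lub A B)"
    and cont: "\<And>m A B A' B'. A \<inter> {..<m} = A' \<inter> {..<m} \<Longrightarrow> B \<inter> {..<m} = B' \<inter> {..<m} \<Longrightarrow>
                 lub A B \<inter> {..<m} = lub A' B' \<inter> {..<m}"
    and closed: "\<And>s l b. \<lbrakk>b \<in> D; \<And>n. le (s n) b; limitin cantor_topology s l sequentially\<rbrakk> \<Longrightarrow> l \<in> D"
  shows "basic (subtopology cantor_topology D) le \<longleftrightarrow> convergent_imp_bounded D le"
proof -
  let ?D = "subtopology cantor_topology D"
  have "continuous_map (prod_topology cantor_topology cantor_topology) cantor_topology
          (\<lambda>(A, B). lub A B)"
    by (rule continuous_map_cantor_binary) (rule cont)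
  then have "continuous_map (prod_topology ?D ?D) ?D (\<lambda>(A, B). lub A B)"
    unfolding prod_topology_subtopology
    by (intro continuous_map_into_subtopology continuous_map_from_subtopology)
      (use lub in \<open>auto simp: is_lub_def topspace_subtopology\<close>)
  moreover have "\<exists>r l. strict_mono r \<and> limitin ?D (s \<circ> r) l sequentially"
    if s: "range s \<subseteq> D" "bounded_seq D le s" for s
  proof -
    obtain b where b: "b \<in> D" "\<And>n. le (s n) b"
      using s(2) unfolding bounded_seq_def by blast
    obtain r l where r: "strict_mono r" "limitin cantor_topology (s \<circ> r) l sequentially"
      by (rule cantor_convergent_subsequence)
    have "l \<in> D" using closed[OF b(1) _ r(2)] b(2) by simp
    then have "limitin ?D (s \<circ> r) l sequentially"
      using r s by (auto simp: limitin_subtopology intro!: always_eventually)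
    then show ?thesis using r(1) by blast
  qed
  moreover have "limitin ?D s l sequentially \<longleftrightarrow> l \<in> D \<and> limitin cantor_topology s l sequentially"
    if "range s \<subseteq> D" for s l
    using that by (auto simp: limitin_subtopology intro!: always_eventually)
  ultimately show ?thesis
    using lub ord metrizable_space_subtopology[OF metrizable_cantor_topology]
    unfolding basic_def convergent_imp_bounded_def
    by (auto simp: separable_subtopology_cantor) blast+
qed

lemma limitin_cantor_mem:
  assumes "limitin cantor_topology s A sequentially"
  shows "eventually (\<lambda>n. i \<in> s n \<longleftrightarrow> i \<in> A) sequentially"
proof -
  obtain k where "\<forall>n\<ge>k. s n \<inter> {..<Suc i} = A \<inter> {..<Suc i}"
    using assms unfolding limitin_cantor_topology by blast
  then show ?thesis unfolding eventually_sequentially by blast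
qed

lemma limitin_cantor_uminus:
  assumes "limitin cantor_topology s A sequentially"
  shows "limitin cantor_topology (\<lambda>n. - s n) (- A) sequentially"
  unfolding limitin_cantor_topology
proof
  fix m
  obtain k where "\<forall>n\<ge>k. s n \<inter> {..<m} = A \<inter> {..<m}"
    using assms unfolding limitin_cantor_topology by blast
  then have "\<forall>n\<ge>k. - s n \<inter> {..<m} = - A \<inter> {..<m}" by blast
  then show "\<exists>k. \<forall>n\<ge>k. - s n \<inter> {..<m} = - A \<inter> {..<m}" by blast
qed

text \<open>Membership of a fixed number is eventually constant along a convergent sequence, so a
  limit of subsets of \<open>b\<close> is a subset of \<open>b\<close>, hence in the ideal.\<close>

lemma basic_ideal_iff:
  assumes "set_ideal \<I>"
  shows "basic (subtopology cantor_topology \<I>) (\<subseteq>) \<longleftrightarrow> convergent_imp_bounded \<I> (\<subseteq>)"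
proof (rule basic_subtopology_cantor_iff[where lub = "(\<union>)"])
  fix s l b
  assume b: "b \<in> \<I>" "\<And>n. s n \<subseteq> b" and lim: "limitin cantor_topology s l sequentially"
  have "l \<subseteq> b"
  proof
    fix i assume "i \<in> l"
    then have "eventually (\<lambda>n. i \<in> s n) sequentially"
      using limitin_cantor_mem[OF lim, of i] by simp
    then show "i \<in> b" using b(2) by (auto simp: eventually_sequentially)
  qed
  then show "l \<in> \<I>" using assms b(1) unfolding set_ideal_def by blast
next
  show "is_lub \<I> (\<subseteq>) A B (A \<union> B)" if "A \<in> \<I>" "B \<in> \<I>" for A B
    using assms that unfolding is_lub_def set_ideal_def by blast
qed (auto simp: reflp_on_def antisymp_on_def transp_on_def)

lemma ultrafilterD:
  assumes "ultrafilter \<U>"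
  shows "{} \<notin> \<U>" "A \<in> \<U> \<Longrightarrow> A \<subseteq> B \<Longrightarrow> B \<in> \<U>"
    "A \<in> \<U> \<Longrightarrow> B \<in> \<U> \<Longrightarrow> A \<inter> B \<in> \<U>" "- A \<notin> \<U> \<Longrightarrow> A \<in> \<U>"
  using assms unfolding ultrafilter_def by metis+

text \<open>Dually, a limit of supersets of \<open>b\<close> includes \<open>b\<close> and so
  belongs to the ultrafilter.\<close>

lemma basic_ultrafilter_iff:
  assumes "ultrafilter \<U>"
  shows "basic (subtopology cantor_topology \<U>) (\<lambda>A B. B \<subseteq> A) \<longleftrightarrow>
         convergent_imp_bounded \<U> (\<lambda>A B. B \<subseteq> A)"
proof (rule basic_subtopology_cantor_iff[where lub = "(\<inter>)"])
  fix s l b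
  assume b: "b \<in> \<U>" "\<And>n. b \<subseteq> s n" and lim: "limitin cantor_topology s l sequentially"
  have "b \<subseteq> l"
  proof
    fix i assume "i \<in> b"
    then show "i \<in> l"
      using b(2) limitin_cantor_mem[OF lim, of i] by (auto simp: eventually_sequentially)
  qed
  then show "l \<in> \<U>" using ultrafilterD(2)[OF assms b(1)] by simp
next
  show "is_lub \<U> (\<lambda>A B. B \<subseteq> A) A B (A \<inter> B)" if "A \<in> \<U>" "B \<in> \<U>" for A B
    using ultrafilterD(3)[OF assms that] by (simp add: is_lub_def)
qed (auto simp: reflp_on_def antisymp_on_def transp_on_def)

subsection \<open>Meager sets in the Cantor space\<close>

text \<open>The complement of the closure is open and meets every cylinder, so each cylinder
  contains a smaller one missing \<open>N\<close>. Demanding \<open>k \<ge> m\<close> makes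
  successive refinements nest.\<close>

lemma nowhere_dense_in_cantor_iff:
  "nowhere_dense_in cantor_topology N \<longleftrightarrow>
     (\<forall>m A. \<exists>k\<ge>m. \<exists>B. B \<inter> {..<m} = A \<inter> {..<m} \<and> (\<forall>X. X \<inter> {..<k} = B \<inter> {..<k} \<longrightarrow> X \<notin> N))"
    (is "_ \<longleftrightarrow> ?R")
proof
  assume N: "nowhere_dense_in cantor_topology N"
  let ?cl = "cantor_topology closure_of N"
  show ?R
  proof (intro allI)
    fix m A
    have "\<not> {B. B \<inter> {..<m} = A \<inter> {..<m}} \<subseteq> ?cl"
    proof
      assume "{B. B \<inter> {..<m} = A \<inter> {..<m}} \<subseteq> ?cl"
      then have "{B. B \<inter> {..<m} = A \<inter> {..<m}} \<subseteq> cantor_topology interior_of ?cl"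
        by (intro interior_of_maximal openin_cantor_cylinder)
      then show False using N unfolding nowhere_dense_in_def by blast
    qed
    then obtain B where B: "B \<inter> {..<m} = A \<inter> {..<m}" "B \<notin> ?cl" by blast
    have "openin cantor_topology (- ?cl)"
      using closedin_closure_of[of cantor_topology N] by (simp add: closedin_def Compl_eq_Diff_UNIV)
    then obtain k where k: "\<And>X. X \<inter> {..<k} = B \<inter> {..<k} \<Longrightarrow> X \<notin> ?cl"
      using B(2) by (metis ComplD ComplI openin_cantor_topologyE)
    have "N \<subseteq> ?cl" by (simp add: closure_of_subset)
    then have "X \<notin> N" if "X \<inter> {..<max m k} = B \<inter> {..<max m k}" for X
      using k[OF cylinder_mono[OF that max.cobounded2]] by blast
    with B(1) show "\<exists>k\<ge>m. \<exists>B. B \<inter> {..<m} = A \<inter> {..<m} \<and> (\<forall>X. X \<inter> {..<k} = B \<inter> {..<k} \<longrightarrow> X \<notin> N)"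
      by (intro exI[of _ "max m k"] exI[of _ B] conjI allI impI max.cobounded1)
  qed
next
  assume R: ?R
  show "nowhere_dense_in cantor_topology N"
  proof (rule ccontr)
    assume "\<not> nowhere_dense_in cantor_topology N"
    then obtain A where "A \<in> cantor_topology interior_of (cantor_topology closure_of N)"
      unfolding nowhere_dense_in_def by auto
    then obtain S where S: "openin cantor_topology S" "A \<in> S" "S \<subseteq> cantor_topology closure_of N"
      unfolding interior_of_def by blast
    then obtain m where m: "\<And>B. B \<inter> {..<m} = A \<inter> {..<m} \<Longrightarrow> B \<in> S"
      using openin_cantor_topologyE by metis
    obtain k B where B: "B \<inter> {..<m} = A \<inter> {..<m}" "\<And>X. X \<inter> {..<k} = B \<inter> {..<k} \<Longrightarrow> X \<notin> N"
      using R by meson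
    have "B \<in> cantor_topology closure_of N" using m[OF B(1)] S(3) by (rule rev_subsetD)
    then have "\<forall>T. B \<in> T \<and> openin cantor_topology T \<longrightarrow> (\<exists>X. X \<in> N \<and> X \<in> T)"
      by (simp add: in_closure_of)
    from this[rule_format, of "{X. X \<inter> {..<k} = B \<inter> {..<k}}"]
    obtain X where "X \<in> N" "X \<inter> {..<k} = B \<inter> {..<k}"
      using openin_cantor_cylinder[of k B] by auto
    then show False using B(2) by simp
  qed
qed

text \<open>Refine a cylinder to miss \<open>M\<close>, then refine the result to miss
  \<open>N\<close>.\<close>

lemma nowhere_dense_in_cantor_Un:
  assumes M: "nowhere_dense_in cantor_topology M" and N: "nowhere_dense_in cantor_topology N"
  shows "nowhere_dense_in cantor_topology (M \<union> N)"
  unfolding nowhere_dense_in_cantor_iff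
proof (intro allI)
  fix m A
  obtain k B where k: "k \<ge> m" "B \<inter> {..<m} = A \<inter> {..<m}"
    "\<And>X. X \<inter> {..<k} = B \<inter> {..<k} \<Longrightarrow> X \<notin> M"
    using M unfolding nowhere_dense_in_cantor_iff by meson
  obtain l C where l: "l \<ge> k" "C \<inter> {..<k} = B \<inter> {..<k}"
    "\<And>X. X \<inter> {..<l} = C \<inter> {..<l} \<Longrightarrow> X \<notin> N"
    using N unfolding nowhere_dense_in_cantor_iff by meson
  have "C \<inter> {..<m} = A \<inter> {..<m}" using cylinder_mono[OF l(2) k(1)] k(2) by simp
  moreover have "X \<notin> M \<union> N" if "X \<inter> {..<l} = C \<inter> {..<l}" for X
    using k(3)[of X] l(3)[OF that] cylinder_mono[OF that l(1)] l(2) by simp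
  moreover have "l \<ge> m" using k l by simp
  ultimately show "\<exists>k\<ge>m. \<exists>B. B \<inter> {..<m} = A \<inter> {..<m} \<and>
      (\<forall>X. X \<inter> {..<k} = B \<inter> {..<k} \<longrightarrow> X \<notin> M \<union> N)"
    by (intro exI[of _ l] exI[of _ C] conjI allI impI)
qed

text \<open>The pattern must work whatever a set does below \<open>m\<close>. There are finitely
  many initial parts, so they can be handled in turn, each time prolonging the pattern.\<close>

lemma nowhere_dense_in_cantor_block:
  assumes N: "nowhere_dense_in cantor_topology N"
  shows "\<exists>k>m. \<exists>s\<subseteq>{m..<k}. \<forall>X. X \<inter> {m..<k} = s \<longrightarrow> X \<notin> N"
proof -
  \<comment> \<open>\<open>T\<close> collects the initial parts already handled; the induction ends
    at the full power set.\<close>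
  have "\<exists>k>m. \<exists>s\<subseteq>{m..<k}. \<forall>X. X \<inter> {m..<k} = s \<and> X \<inter> {..<m} \<in> T \<longrightarrow> X \<notin> N"
    if "finite T" "T \<subseteq> Pow {..<m}" for T
    using that
  proof (induction T)
    case empty
    show ?case by (intro exI[of _ "Suc m"] exI[of _ "{}"]) auto
  next
    case (insert t T)
    then obtain k s where k: "k > m" "s \<subseteq> {m..<k}"
      "\<And>X. X \<inter> {m..<k} = s \<Longrightarrow> X \<inter> {..<m} \<in> T \<Longrightarrow> X \<notin> N"
      by auto
    \<comment> \<open>The cylinder of length \<open>k\<close> through \<open>t \<union> s\<close> is
      refined. So \<open>u\<close> agrees with \<open>t\<close> below \<open>m\<close> and with
      \<open>s\<close> on the old block, which keeps the earlier parts handled.\<close>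
    obtain l u where l: "l \<ge> k" "u \<inter> {..<k} = (t \<union> s) \<inter> {..<k}"
      "\<And>X. X \<inter> {..<l} = u \<inter> {..<l} \<Longrightarrow> X \<notin> N"
      using N unfolding nowhere_dense_in_cantor_iff by meson
    have t: "t \<subseteq> {..<m}" using insert.prems by auto
    have u: "i \<in> u \<longleftrightarrow> i \<in> t \<or> i \<in> s" if "i < k" for i
      using l(2) that by (auto simp: set_eq_iff)
    have u_low: "i \<in> u \<longleftrightarrow> i \<in> t" if "i < m" for i
      using u[of i] k(1) subsetD[OF k(2), of i] that by auto
    have u_mid: "i \<in> u \<longleftrightarrow> i \<in> s" if "m \<le> i" "i < k" for i
      using u[of i] subsetD[OF t, of i] that by auto
    have "X \<notin> N" if X: "X \<inter> {m..<l} = u \<inter> {m..<l}" "X \<inter> {..<m} \<in> insert t T" for X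
    proof (cases "X \<inter> {..<m} = t")
      case True
      have "i \<in> X \<longleftrightarrow> i \<in> u" if "i < l" for i
      proof (cases "i < m")
        case True
        then show ?thesis using \<open>X \<inter> {..<m} = t\<close> u_low[of i] by auto
      next
        case False
        then show ?thesis using arg_cong[OF X(1), of "\<lambda>S. i \<in> S"] that by simp
      qed
      then have "X \<inter> {..<l} = u \<inter> {..<l}" by auto
      then show ?thesis by (rule l(3))
    next
      case False
      have "i \<in> X \<longleftrightarrow> i \<in> s" if "m \<le> i" "i < k" for i
        using arg_cong[OF X(1), of "\<lambda>S. i \<in> S"] u_mid[OF that] that l(1) by simp
      then have "X \<inter> {m..<k} = s" using k(2) by auto
      moreover have "X \<inter> {..<m} \<in> T" using X(2) False by simp
      ultimately show ?thesis by (rule k(3))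
    qed
    then have "\<forall>X. X \<inter> {m..<l} = u \<inter> {m..<l} \<and> X \<inter> {..<m} \<in> insert t T \<longrightarrow> X \<notin> N"
      by simp
    moreover have "m < l" using k(1) l(1) by simp
    ultimately show ?case
      by (intro exI[of _ l] conjI exI[of _ "u \<inter> {m..<l}"] Int_lower2)
  qed
  from this[of "Pow {..<m}"] show ?thesis by auto
qed

text \<open>
  Write \<open>M\<close> as the union of nowhere dense sets \<open>N i\<close>. The set \<open>s k\<close> is a pattern on the block
  \<open>{p k..<p (Suc k)}\<close> which forces any set displaying it out of all \<open>N i\<close> with \<open>i \<le> k\<close>.
\<close>

lemma meager_in_cantor_blocks:
  assumes "meager_in cantor_topology M"
  obtains s :: "nat \<Rightarrow> nat set" where "\<And>k. finite (s k)" "\<And>k. s k \<subseteq> {k..}"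
    "\<And>i j. i \<noteq> j \<Longrightarrow> s i \<inter> s j = {}" "\<And>K. infinite K \<Longrightarrow> (\<Union>k\<in>K. s k) \<notin> M"
proof -
  obtain \<N> where \<N>: "countable \<N>" "\<And>N. N \<in> \<N> \<Longrightarrow> nowhere_dense_in cantor_topology N" "M = \<Union>\<N>"
    using assms unfolding meager_in_def by blast
  \<comment> \<open>Inserting the empty set, itself nowhere dense, makes the enumerated family
    nonempty, as surjectivity of the enumeration requires.\<close>
  define N where "N = from_nat_into (insert {} \<N>)"
  have ran: "range N = insert {} \<N>"
    unfolding N_def using \<N>(1) by (simp add: range_from_nat_into)
  have nd: "nowhere_dense_in cantor_topology (N n)" for n
  proof -
    have "N n \<in> insert {} \<N>" using ran by blast
    then show ?thesis using \<N>(2) by (auto simp: nowhere_dense_in_def)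
  qed
  \<comment> \<open>Finite unions let a single block avoid \<open>N 0\<close> up to
    \<open>N n\<close> together.\<close>
  have "nowhere_dense_in cantor_topology (\<Union>i\<le>n. N i)" for n
    by (induction n) (auto simp: atMost_Suc nd intro!: nowhere_dense_in_cantor_Un)
  then have "\<forall>n m. \<exists>k>m. \<exists>s\<subseteq>{m..<k}. \<forall>X. X \<inter> {m..<k} = s \<longrightarrow> X \<notin> (\<Union>i\<le>n. N i)"
    using nowhere_dense_in_cantor_block by blast
  then obtain f g where fg: "\<And>n m. f n m > m" "\<And>n m. g n m \<subseteq> {m..<f n m}"
    "\<And>n m X. X \<inter> {m..<f n m} = g n m \<Longrightarrow> X \<notin> (\<Union>i\<le>n. N i)"
    by metis
  \<comment> \<open>\<open>p n\<close> is the left end of block \<open>n\<close>; each block starts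
    where the previous one stops.\<close>
  define p where "p = rec_nat 0 f"
  have p_Suc: "p (Suc n) = f n (p n)" for n by (simp add: p_def)
  have p: "strict_mono p" by (simp add: strict_mono_Suc_iff p_Suc fg)
  define s where "s n = g n (p n)" for n
  have s: "s n \<subseteq> {p n..<p (Suc n)}" for n
    unfolding s_def p_Suc by (rule fg)
  have disj: "{p i..<p (Suc i)} \<inter> {p j..<p (Suc j)} = {}" if "i \<noteq> j" for i j
  proof -
    have "p (Suc i) \<le> p j" if "i < j" for i j
      using that p by (simp add: strict_mono_less_eq Suc_le_eq)
    from this[of i j] this[of j i] show ?thesis
      using \<open>i \<noteq> j\<close> by (cases "i < j") auto
  qed
  show thesis
  proof
    show "finite (s k)" for k using s[of k] finite_subset by blast
    show "s k \<subseteq> {k..}" for k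
    proof
      fix i assume "i \<in> s k"
      then have "p k \<le> i" using s[of k] by auto
      moreover have "k \<le> p k" using p by (rule strict_mono_imp_increasing)
      ultimately show "i \<in> {k..}" by simp
    qed
    show "s i \<inter> s j = {}" if "i \<noteq> j" for i j
      using disj[OF that] s[of i] s[of j] by blast
    show "(\<Union>k\<in>K. s k) \<notin> M" if "infinite K" for K
    proof
      assume "(\<Union>k\<in>K. s k) \<in> M"
      then obtain i where i: "(\<Union>k\<in>K. s k) \<in> N i" using \<N>(3) ran by (metis UnionE insertI2 rangeE)
      obtain k where k: "k \<in> K" "i \<le> k"
        using \<open>infinite K\<close> unfolding infinite_nat_iff_unbounded_le by blast
      \<comment> \<open>Blocks are disjoint, so on block \<open>k\<close> the union displays exactly
        \<open>s k\<close>; since \<open>i \<le> k\<close>, this excludes it from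
        \<open>N i\<close>.\<close>
      have "(\<Union>k\<in>K. s k) \<inter> {p k..<p (Suc k)} = s k"
      proof (intro equalityI subsetI)
        fix i assume "i \<in> (\<Union>k\<in>K. s k) \<inter> {p k..<p (Suc k)}"
        then obtain j where j: "i \<in> s j" "i \<in> {p k..<p (Suc k)}" by blast
        then have "j = k" using s[of j] disj[of j k] by blast
        then show "i \<in> s k" using j by simp
      qed (use k(1) s[of k] in blast)
      then have "(\<Union>k\<in>K. s k) \<notin> (\<Union>i\<le>k. N i)"
        using fg(3)[of "\<Union>k\<in>K. s k" "p k" k] by (simp add: s_def p_Suc)
      then show False using i k(2) by blast
    qed
  qed
qed

text \<open>The members of \<open>M\<close> that include only finitely many \<open>C n\<close> form
  a meager set: any cylinder can be refined by adding a late \<open>C n\<close> lying beyond its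
  length. So \<open>M\<close> has a further member.\<close>

lemma not_meager_in_cantor_Union_infinite:
  assumes M: "\<not> meager_in cantor_topology M"
    and C: "\<And>n. finite (C n)" "\<And>m. eventually (\<lambda>n. C n \<inter> {..<m} = {}) sequentially"
  obtains X where "X \<in> M" "infinite {n. C n \<subseteq> X}"
proof -
  define N where "N m = M \<inter> {X. \<forall>n\<ge>m. \<not> C n \<subseteq> X}" for m
  have "nowhere_dense_in cantor_topology (N m)" for m
    unfolding nowhere_dense_in_cantor_iff
  proof (intro allI)
    fix l A
    obtain n where n: "n \<ge> m" "C n \<inter> {..<l} = {}"
      using C(2)[of l] unfolding eventually_sequentially by (meson linorder_linear)
    obtain k where k: "\<forall>i\<in>C n. i < k" using C(1) finite_nat_set_iff_bounded by blast
    \<comment> \<open>Adding \<open>C n\<close> stays in the given cylinder, and since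
      \<open>k\<close> bounds \<open>C n\<close>, the longer cylinder forces
      \<open>C n \<subseteq> X\<close>.\<close>
    have "(A \<union> C n) \<inter> {..<l} = A \<inter> {..<l}" using n(2) by blast
    moreover have "X \<notin> N m" if "X \<inter> {..<max l k} = (A \<union> C n) \<inter> {..<max l k}" for X
    proof -
      have "C n \<subseteq> (A \<union> C n) \<inter> {..<max l k}" using k by auto
      then have "C n \<subseteq> X" using that by blast
      then show ?thesis using n(1) by (auto simp: N_def)
    qed
    ultimately show "\<exists>k\<ge>l. \<exists>B. B \<inter> {..<l} = A \<inter> {..<l} \<and>
        (\<forall>X. X \<inter> {..<k} = B \<inter> {..<k} \<longrightarrow> X \<notin> N m)"
      by (intro exI[of _ "max l k"] exI[of _ "A \<union> C n"] conjI allI impI max.cobounded1)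
  qed
  then have "meager_in cantor_topology (\<Union>(range N))"
    unfolding meager_in_def by (intro exI[of _ "range N"]) auto
  then have "M \<noteq> \<Union>(range N)" using M by metis
  moreover have "\<Union>(range N) \<subseteq> M" by (auto simp: N_def)
  ultimately obtain X where "X \<in> M" "\<And>m. X \<notin> N m" by blast
  moreover from this have "infinite {n. C n \<subseteq> X}"
    by (simp add: infinite_nat_iff_unbounded_le N_def)
  ultimately show thesis using that by blast
qed

subsection \<open>Ideals and ultrafilters\<close>

lemma set_idealD:
  assumes "set_ideal \<I>"
  shows "A \<in> \<I> \<Longrightarrow> B \<subseteq> A \<Longrightarrow> B \<in> \<I>" "A \<in> \<I> \<Longrightarrow> B \<in> \<I> \<Longrightarrow> A \<union> B \<in> \<I>"
  using assms unfolding set_ideal_def by metis+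

lemma set_ideal_UN_atMost:
  assumes "set_ideal \<I>" "range A \<subseteq> \<I>"
  shows "(\<Union>i\<le>(n::nat). A i) \<in> \<I>"
  using assms(2) by (induction n) (auto simp: atMost_Suc image_subset_iff
      intro!: set_idealD(2)[OF assms(1)])

lemma convergent_imp_bounded_ideal_iff:
  assumes I: "set_ideal \<I>" and fin: "\<And>F. finite F \<Longrightarrow> F \<in> \<I>"
  shows "convergent_imp_bounded \<I> (\<subseteq>) \<longleftrightarrow> \<not> meager_in cantor_topology \<I> \<and> p_ideal \<I>"
proof
  assume b: "convergent_imp_bounded \<I> (\<subseteq>)"
  \<comment> \<open>Sets receding to infinity converge to the empty set, a member of the ideal.
    Non-meagerness and the p-ideal property both follow from this special case.\<close>
  have null: "\<exists>(r :: nat \<Rightarrow> nat) B. strict_mono r \<and> B \<in> \<I> \<and> (\<forall>n. s (r n) \<subseteq> B)"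
    if s: "\<And>n. s n \<in> \<I>" "\<And>n. s n \<subseteq> {n..}" for s :: "nat \<Rightarrow> nat set"
  proof -
    have "s n \<inter> {..<m} = {} \<inter> {..<m}" if "n \<ge> m" for m n
      using s(2)[of n] that by fastforce
    then have "limitin cantor_topology s {} sequentially"
      unfolding limitin_cantor_topology by blast
    moreover have "range s \<subseteq> \<I>" "{} \<in> \<I>" using s(1) fin by auto
    ultimately obtain r where r: "strict_mono r" "bounded_seq \<I> (\<subseteq>) (s \<circ> r)"
      using b unfolding convergent_imp_bounded_def by meson
    from r(2) obtain B where "B \<in> \<I>" "\<forall>n. s (r n) \<subseteq> B"
      unfolding bounded_seq_def comp_def by (elim bexE)
    with r(1) show ?thesis by blast
  qed
  show "\<not> meager_in cantor_topology \<I> \<and> p_ideal \<I>"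
  proof
    show "\<not> meager_in cantor_topology \<I>"
    proof
      assume "meager_in cantor_topology \<I>"
      then obtain s :: "nat \<Rightarrow> nat set" where s: "\<And>k. finite (s k)" "\<And>k. s k \<subseteq> {k..}"
        "\<And>K. infinite K \<Longrightarrow> (\<Union>k\<in>K. s k) \<notin> \<I>"
        by (rule meager_in_cantor_blocks) blast
      \<comment> \<open>Such a bound includes the union of infinitely many \<open>s k\<close>, which
        by choice of \<open>s\<close> is not in the ideal.\<close>
      obtain r :: "nat \<Rightarrow> nat" and B where r: "strict_mono r" "B \<in> \<I>" "\<And>n. s (r n) \<subseteq> B"
        using null[of s] s(2) fin[OF s(1)] by blast
      have "infinite (range r)"
        using r(1) by (simp add: strict_mono_imp_inj_on range_inj_infinite)
      then have "(\<Union>k\<in>range r. s k) \<notin> \<I>" by (rule s(3))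
      moreover have "(\<Union>k\<in>range r. s k) \<subseteq> B" using r(3) by blast
      ultimately show False using set_idealD(1)[OF I r(2)] by blast
    qed
    have "\<exists>B\<in>\<I>. \<forall>n. A n \<subseteq>\<^sup>* B" if A: "range A \<subseteq> \<I>" for A :: "nat \<Rightarrow> nat set"
    proof -
      \<comment> \<open>Truncation makes the finite unions tend to the empty set. A bound along
        \<open>r\<close> includes the part of \<open>A n\<close> from \<open>r n\<close> on, because
        \<open>n \<le> r n\<close>.\<close>
      have "(\<Union>i\<le>n. A i) \<inter> {n..} \<in> \<I>" for n
        by (rule set_idealD(1)[OF I set_ideal_UN_atMost[OF I A] Int_lower1])
      then obtain r :: "nat \<Rightarrow> nat" and B where r: "strict_mono r" "B \<in> \<I>" "\<And>n. (\<Union>i\<le>r n. A i) \<inter> {r n..} \<subseteq> B"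
        using null[of "\<lambda>n. (\<Union>i\<le>n. A i) \<inter> {n..}"] by auto
      have "A n - B \<subseteq> {..<r n}" for n
      proof
        fix i assume i: "i \<in> A n - B"
        have "n \<le> r n" using r(1) by (simp add: strict_mono_imp_increasing)
        then show "i \<in> {..<r n}" using i r(3)[of n] by (force simp: not_less)
      qed
      then show ?thesis
        using r(2) finite_subset unfolding almost_subset_def by blast
    qed
    then show "p_ideal \<I>" using I unfolding p_ideal_def by blast
  qed
next
  assume R: "\<not> meager_in cantor_topology \<I> \<and> p_ideal \<I>"
  show "convergent_imp_bounded \<I> (\<subseteq>)"
    unfolding convergent_imp_bounded_def
  proof (intro allI impI, elim conjE)
    fix s l
    assume s: "range s \<subseteq> \<I>" and l: "l \<in> \<I>" and lim: "limitin cantor_topology s l sequentially"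
    obtain B0 where B0: "B0 \<in> \<I>" "\<And>n. s n \<subseteq>\<^sup>* B0"
      using R s unfolding p_ideal_def by blast
    \<comment> \<open>\<open>B0\<close> makes the remainders \<open>s n - B\<close> finite;
      \<open>l\<close> makes them converge to the empty set, as \<open>s n\<close> eventually agrees
      with \<open>l\<close> below each \<open>m\<close>.\<close>
    define B where "B = B0 \<union> l"
    have B: "B \<in> \<I>" using set_idealD(2)[OF I B0(1) l] unfolding B_def .
    have "eventually (\<lambda>n. (s n - B) \<inter> {..<m} = {}) sequentially" for m
    proof -
      obtain k where "\<forall>n\<ge>k. s n \<inter> {..<m} = l \<inter> {..<m}"
        using lim unfolding limitin_cantor_topology by blast
      then show ?thesis unfolding eventually_sequentially B_def by blast
    qed
    moreover have "finite (s n - B)" for n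
      using B0(2)[of n] finite_subset[of "s n - B" "s n - B0"]
      unfolding B_def almost_subset_def by blast
    ultimately obtain X where X: "X \<in> \<I>" "infinite {n. s n - B \<subseteq> X}"
      using not_meager_in_cantor_Union_infinite[of \<I> "\<lambda>n. s n - B"] R by blast
    obtain r :: "nat \<Rightarrow> nat" where r: "strict_mono r" "\<And>n. r n \<in> {n. s n - B \<subseteq> X}"
      using infinite_enumerate[OF X(2)] by blast
    have "s (r n) \<subseteq> B \<union> X" for n using r(2)[of n] by blast
    moreover have "B \<union> X \<in> \<I>" using set_idealD(2)[OF I B X(1)] .
    ultimately have "bounded_seq \<I> (\<subseteq>) (s \<circ> r)"
      unfolding bounded_seq_def comp_def by blast
    with r(1) show "\<exists>r. strict_mono r \<and> bounded_seq \<I> (\<subseteq>) (s \<circ> r)" by blast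
  qed
qed

section \<open>Ultrafilters and their dual ideals\<close>

text \<open>A finite member of least cardinality cannot shrink when intersected with another member,
  so it would be included in every member and generate the ultrafilter.\<close>

lemma nonprincipal_ultrafilter_infinite:
  assumes U: "ultrafilter \<U>" and np: "nonprincipal \<U>" and A: "A \<in> \<U>"
  shows "infinite A"
proof
  assume "finite A"
  with A obtain S where S: "finite S" "S \<in> \<U>" "\<And>T. finite T \<Longrightarrow> T \<in> \<U> \<Longrightarrow> card S \<le> card T"
    using arg_min_nat_lemma[of "\<lambda>T. finite T \<and> T \<in> \<U>" A card] by auto
  have "S \<subseteq> B" if "B \<in> \<U>" for B
  proof -
    have "S \<inter> B \<in> \<U>" using ultrafilterD(3)[OF U S(2) that] .
    then have "S \<inter> B = S" using S by (intro card_seteq) auto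
    then show ?thesis by blast
  qed
  then have "\<U> = {A. S \<subseteq> A}"
    using ultrafilterD(2)[OF U S(2)] by blast
  then show False using np unfolding nonprincipal_def by blast
qed

definition dual_ideal :: "nat set set \<Rightarrow> nat set set" where
  "dual_ideal \<U> = {A. - A \<in> \<U>}"

lemma set_ideal_dual_ideal:
  assumes "ultrafilter \<U>"
  shows "set_ideal (dual_ideal \<U>)"
  unfolding set_ideal_def
proof (intro conjI allI impI; (elim conjE)?)
  show "{} \<in> dual_ideal \<U>"
    using assms by (simp add: dual_ideal_def ultrafilter_def)
  show "B \<in> dual_ideal \<U>" if "A \<in> dual_ideal \<U>" "B \<subseteq> A" for A B
    using that ultrafilterD(2)[OF assms, of "- A" "- B"] by (simp add: dual_ideal_def)
  show "A \<union> B \<in> dual_ideal \<U>" if "A \<in> dual_ideal \<U>" "B \<in> dual_ideal \<U>" for A B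
    using that ultrafilterD(3)[OF assms, of "- A" "- B"] by (simp add: dual_ideal_def)
qed

lemma finite_in_dual_ideal:
  assumes "ultrafilter \<U>" "nonprincipal \<U>" "finite F"
  shows "F \<in> dual_ideal \<U>"
  using assms(3) nonprincipal_ultrafilter_infinite[OF assms(1,2), of F]
    ultrafilterD(4)[OF assms(1), of "- F"]
  unfolding dual_ideal_def by auto

lemma dual_ideal_not_meager:
  assumes U: "ultrafilter \<U>"
  shows "\<not> meager_in cantor_topology (dual_ideal \<U>)"
proof
  assume "meager_in cantor_topology (dual_ideal \<U>)"
  then obtain s :: "nat \<Rightarrow> nat set" where s: "\<And>i j. i \<noteq> j \<Longrightarrow> s i \<inter> s j = {}"
    "\<And>K. infinite K \<Longrightarrow> (\<Union>k\<in>K. s k) \<notin> dual_ideal \<U>"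
    by (rule meager_in_cantor_blocks) blast
  let ?E = "\<Union>k\<in>{k. even k}. s k" and ?O = "\<Union>k\<in>{k. odd k}. s k"
  have "infinite {k::nat. even k}" "infinite {k::nat. odd k}"
    unfolding infinite_nat_iff_unbounded_le by (metis mem_Collect_eq even_Suc le_SucI order_refl)+
  \<comment> \<open>Neither union is in the dual ideal, so neither complement is in
    \<open>\<U>\<close>, and maximality puts both unions there.\<close>
  then have "?E \<in> \<U>" "?O \<in> \<U>"
    using s(2) unfolding dual_ideal_def by (auto intro!: ultrafilterD(4)[OF U])
  then have "?E \<inter> ?O \<in> \<U>" by (rule ultrafilterD(3)[OF U])
  moreover have "?E \<inter> ?O = {}"
  proof (rule equals0I)
    fix n assume "n \<in> ?E \<inter> ?O"
    then obtain i j where "even i" "n \<in> s i" "odd j" "n \<in> s j" by blast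
    then show False using s(1)[of i j] by blast
  qed
  ultimately show False using ultrafilterD(1)[OF U] by simp
qed

text \<open>Complementation preserves convergence and is an order isomorphism between
  \<open>E\<close> and \<open>D\<close>, so bounded subsequences can be transported back.\<close>

lemma convergent_imp_bounded_uminus:
  assumes D: "convergent_imp_bounded D le"
    and E: "\<And>A. A \<in> E \<longleftrightarrow> - A \<in> D" and le': "\<And>A B. le' A B \<longleftrightarrow> le (- A) (- B)"
  shows "convergent_imp_bounded E le'"
  unfolding convergent_imp_bounded_def
proof (intro allI impI, elim conjE)
  fix s :: "nat \<Rightarrow> nat set" and l
  assume s: "range s \<subseteq> E" "l \<in> E" "limitin cantor_topology s l sequentially"
  have "range (\<lambda>n. - s n) \<subseteq> D \<and> - l \<in> D \<and>
      limitin cantor_topology (\<lambda>n. - s n) (- l) sequentially"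
    using s(1,2) limitin_cantor_uminus[OF s(3)] by (simp add: E image_subset_iff)
  then obtain r where r: "strict_mono r" "bounded_seq D le ((\<lambda>n. - s n) \<circ> r)"
    using D unfolding convergent_imp_bounded_def by meson
  from r(2) obtain B where B: "B \<in> D" "\<forall>n. le (- s (r n)) B"
    unfolding bounded_seq_def comp_def by (elim bexE)
  then have "- B \<in> E" "\<forall>n. le' (s (r n)) (- B)" by (simp_all add: E le')
  then have "bounded_seq E le' (s \<circ> r)"
    unfolding bounded_seq_def comp_def by (intro bexI)
  with r(1) show "\<exists>r. strict_mono r \<and> bounded_seq E le' (s \<circ> r)" by blast
qed

lemma convergent_imp_bounded_dual_ideal:
  "convergent_imp_bounded (dual_ideal \<U>) (\<subseteq>) \<longleftrightarrow> convergent_imp_bounded \<U> (\<lambda>A B. B \<subseteq> A)"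
proof
  show "convergent_imp_bounded \<U> (\<lambda>A B. B \<subseteq> A)" if "convergent_imp_bounded (dual_ideal \<U>) (\<subseteq>)"
    using that by (rule convergent_imp_bounded_uminus) (simp_all add: dual_ideal_def)
  show "convergent_imp_bounded (dual_ideal \<U>) (\<subseteq>)" if "convergent_imp_bounded \<U> (\<lambda>A B. B \<subseteq> A)"
    using that by (rule convergent_imp_bounded_uminus) (simp_all add: dual_ideal_def)
qed

lemma almost_subset_Compl_iff: "- A \<subseteq>\<^sup>* - B \<longleftrightarrow> B \<subseteq>\<^sup>* A"
  by (simp add: almost_subset_def Diff_eq Int_commute)

text \<open>Complementation reverses almost inclusion, turning a bound \<open>B\<close> in the dual
  ideal into a pseudo-intersection \<open>- B\<close> in \<open>\<U>\<close>, and back.\<close>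

lemma p_ideal_dual_ideal_iff:
  assumes U: "ultrafilter \<U>"
  shows "p_ideal (dual_ideal \<U>) \<longleftrightarrow> p_point \<U>"
proof
  assume L: "p_ideal (dual_ideal \<U>)"
  have "\<exists>Y\<in>\<U>. \<forall>n. Y \<subseteq>\<^sup>* X n" if "range X \<subseteq> \<U>" for X :: "nat \<Rightarrow> nat set"
  proof -
    have "range (\<lambda>n. - X n) \<subseteq> dual_ideal \<U>" using that by (auto simp: dual_ideal_def)
    then obtain B where "B \<in> dual_ideal \<U>" "\<And>n. - X n \<subseteq>\<^sup>* B"
      using L unfolding p_ideal_def by meson
    then show ?thesis
      using almost_subset_Compl_iff[of "X _" "- B"]
      by (intro bexI[of _ "- B"]) (simp_all add: dual_ideal_def)
  qed
  then show "p_point \<U>" using U unfolding p_point_def by blast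
next
  assume L: "p_point \<U>"
  have "\<exists>B\<in>dual_ideal \<U>. \<forall>n. A n \<subseteq>\<^sup>* B" if "range A \<subseteq> dual_ideal \<U>" for A :: "nat \<Rightarrow> nat set"
  proof -
    have "range (\<lambda>n. - A n) \<subseteq> \<U>" using that by (auto simp: dual_ideal_def)
    then obtain Y where "Y \<in> \<U>" "\<And>n. Y \<subseteq>\<^sup>* - A n"
      using L unfolding p_point_def by meson
    then show ?thesis
      using almost_subset_Compl_iff[of "- Y" "A _"]
      by (intro bexI[of _ "- Y"]) (simp_all add: dual_ideal_def)
  qed
  then show "p_ideal (dual_ideal \<U>)"
    using set_ideal_dual_ideal[OF U] unfolding p_ideal_def by blast
qed

theorem theorem15:
  shows "(\<forall>\<I> :: nat set set.
            set_ideal \<I> \<and> (\<forall>F. finite F \<longrightarrow> F \<in> \<I>) \<longrightarrow>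
            (basic (subtopology cantor_topology \<I>) (\<lambda>A B. A \<subseteq> B) \<longleftrightarrow>
             \<not> meager_in cantor_topology \<I> \<and> p_ideal \<I>)) \<and>
         (\<forall>\<U> :: nat set set.
            ultrafilter \<U> \<and> nonprincipal \<U> \<longrightarrow>
            (basic (subtopology cantor_topology \<U>) (\<lambda>A B. B \<subseteq> A) \<longleftrightarrow> p_point \<U>))"
proof (intro conjI allI impI; elim conjE)
  fix \<I> :: "nat set set"
  assume "set_ideal \<I>" "\<forall>F. finite F \<longrightarrow> F \<in> \<I>"
  then show "basic (subtopology cantor_topology \<I>) (\<lambda>A B. A \<subseteq> B) \<longleftrightarrow>
      \<not> meager_in cantor_topology \<I> \<and> p_ideal \<I>"
    by (simp add: basic_ideal_iff convergent_imp_bounded_ideal_iff)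
next
  fix \<U> :: "nat set set"
  assume U: "ultrafilter \<U>" "nonprincipal \<U>"
  have "basic (subtopology cantor_topology \<U>) (\<lambda>A B. B \<subseteq> A) \<longleftrightarrow>
          convergent_imp_bounded (dual_ideal \<U>) (\<subseteq>)"
    using basic_ultrafilter_iff[OF U(1)] convergent_imp_bounded_dual_ideal by simp
  \<comment> \<open>A dual ideal is never meager, so only the p-ideal condition remains.\<close>
  also have "\<dots> \<longleftrightarrow> p_ideal (dual_ideal \<U>)"
    using convergent_imp_bounded_ideal_iff[OF set_ideal_dual_ideal[OF U(1)] finite_in_dual_ideal[OF U]]
      dual_ideal_not_meager[OF U(1)] by simp
  also have "\<dots> \<longleftrightarrow> p_point \<U>" by (rule p_ideal_dual_ideal_iff[OF U(1)])
  finally show "basic (subtopology cantor_topology \<U>) (\<lambda>A B. B \<subseteq> A) \<longleftrightarrow> p_point \<U>" .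
qed

end
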